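(* For all $k\ge5$ and $n\ge\binom{k-1}{2}+2$, there are two distinct maximal $C_k$-matroids on $K_n$ (maximal with respect to the weak order).
   Context: $C_k$ is the cycle with $k$ edges. A $C_k$-matroid on $K_n$ is a matroid on $E(K_n)$ in which the edge set of every subgraph isomorphic to $C_k$ is a circuit. Weak order: ${\mathcal M}_1\preceq{\mathcal M}_2$ if every independent set of ${\mathcal M}_1$ is independent in ${\mathcal M}_2$. *)

theory Defs
  imports Complex_Main
begin

text \<open>
  A matroid on a fixed finite ground set \<open>E\<close> is represented by its family \<open>I\<close> of independent
  sets. Since all members of \<open>I\<close> are subsets of \<open>E\<close>, two matroids on \<open>E\<close> are equal iff their
  families are equal.
\<close>

definition matroid_on :: "'a set \<Rightarrow> 'a set set \<Rightarrow> bool" where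
  "matroid_on E I \<longleftrightarrow>
     finite E \<and> I \<subseteq> Pow E \<and> {} \<in> I \<and>
     (\<forall>X Y. X \<in> I \<longrightarrow> Y \<subseteq> X \<longrightarrow> Y \<in> I) \<and>
     (\<forall>X Y. X \<in> I \<longrightarrow> Y \<in> I \<longrightarrow> card X < card Y \<longrightarrow> (\<exists>e \<in> Y - X. insert e X \<in> I))"

definition circuit :: "'a set \<Rightarrow> 'a set set \<Rightarrow> 'a set \<Rightarrow> bool" where
  "circuit E I C \<longleftrightarrow> C \<subseteq> E \<and> C \<notin> I \<and> (\<forall>D. D \<subset> C \<longrightarrow> D \<in> I)"

definition weak_le :: "'a set set \<Rightarrow> 'a set set \<Rightarrow> bool" where
  "weak_le I1 I2 \<longleftrightarrow> (\<forall>X. X \<in> I1 \<longrightarrow> X \<in> I2)"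

definition complete_edges :: "nat \<Rightarrow> nat set set" where
  "complete_edges n = {e. e \<subseteq> {..<n} \<and> card e = 2}"

text \<open>This is a cycle with \<open>k\<close> edges only for \<open>k \<ge> 3\<close>.\<close>

definition cycle_edges :: "nat \<Rightarrow> nat set set" where
  "cycle_edges k = {{i, (i + 1) mod k} | i. i < k}"

text \<open>
  Subgraphs of \<open>K\<^sub>n\<close> isomorphic to \<open>C\<^sub>k\<close> are the images of \<open>C\<^sub>k\<close> under injections of its
  vertex set into that of \<open>K\<^sub>n\<close>.
\<close>

definition cycle_copies :: "nat \<Rightarrow> nat \<Rightarrow> nat set set set" where
  "cycle_copies k n =
     {(\<lambda>e. f ` e) ` cycle_edges k | f. inj_on f {..<k} \<and> f ` {..<k} \<subseteq> {..<n}}"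

definition Ck_matroid_on :: "nat \<Rightarrow> nat \<Rightarrow> nat set set set \<Rightarrow> bool" where
  "Ck_matroid_on k n I \<longleftrightarrow>
     matroid_on (complete_edges n) I \<and>
     (\<forall>C \<in> cycle_copies k n. circuit (complete_edges n) I C)"

definition maximal_Ck_matroid_on :: "nat \<Rightarrow> nat \<Rightarrow> nat set set set \<Rightarrow> bool" where
  "maximal_Ck_matroid_on k n I \<longleftrightarrow>
     Ck_matroid_on k n I \<and>
     (\<forall>J. Ck_matroid_on k n J \<longrightarrow> weak_le I J \<longrightarrow> J = I)"

end

theory Submission
  imports Defs
begin

text \<open>
  The graphic matroid of \<open>K\<^sub>n\<close> and the sparse paving matroid of rank \<open>k\<close> whose dependent
  \<open>k\<close>-sets are the \<open>k\<close>-cycles are both \<open>C\<^sub>k\<close>-matroids. They have no common upper bound \<open>M\<close> among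
  the \<open>C\<^sub>k\<close>-matroids: the rank \<open>n - 1\<close> of \<open>M\<close> exceeds the number of edges of the complete graph on
  \<open>S = {0, ..., k - 2}\<close>, so some edge \<open>{v, 0}\<close> with \<open>v \<notin> S\<close> is not spanned by it. The Hamiltonian
  paths \<open>0, 1, 2, 3, ..., k - 2\<close> and \<open>0, 2, 1, 3, ..., k - 2\<close> of \<open>S\<close> close up through \<open>v\<close> to two
  \<open>k\<close>-cycles, so the union of the paths must be dependent; but it has only \<open>k\<close> edges and is not a
  \<open>k\<close>-cycle, so it is independent in the sparse paving matroid.
\<close>

section \<open>Matroids\<close>

lemma matroid_on_indepD:
  assumes "matroid_on E I" "X \<in> I"
  shows "X \<subseteq> E" "finite X" "\<And>Y. Y \<subseteq> X \<Longrightarrow> Y \<in> I"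
proof -
  show "X \<subseteq> E" "\<And>Y. Y \<subseteq> X \<Longrightarrow> Y \<in> I"
    using assms unfolding matroid_on_def by blast+
  then show "finite X"
    using assms unfolding matroid_on_def by (meson finite_subset)
qed

lemma matroid_onI:
  assumes "finite E" "\<And>X. X \<in> I \<Longrightarrow> X \<subseteq> E" "{} \<in> I"
    "\<And>X Y. X \<in> I \<Longrightarrow> Y \<subseteq> X \<Longrightarrow> Y \<in> I"
    "\<And>X Y. X \<in> I \<Longrightarrow> Y \<in> I \<Longrightarrow> card X < card Y \<Longrightarrow> \<exists>e \<in> Y - X. insert e X \<in> I"
  shows "matroid_on E I"
  using assms unfolding matroid_on_def by blast

text \<open>For \<open>e\<close> in the ground set,
  \<open>insert e B \<in> I \<Longrightarrow> e \<in> B\<close> says that the independent set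
  \<open>B\<close> spans \<open>e\<close>; so the set obtained here is a basis of \<open>A\<close>.
  Spanning is expressed in this form throughout.\<close>

lemma matroid_on_extend:
  assumes M: "matroid_on E I" and "X \<in> I" "X \<subseteq> A" "A \<subseteq> E"
  obtains B where "B \<in> I" "X \<subseteq> B" "B \<subseteq> A" "\<And>e. e \<in> A \<Longrightarrow> insert e B \<in> I \<Longrightarrow> e \<in> B"
proof -
  let ?F = "{B \<in> I. X \<subseteq> B \<and> B \<subseteq> A}"
  have "finite A"
    using M \<open>A \<subseteq> E\<close> unfolding matroid_on_def by (auto intro: finite_subset)
  then have "finite ?F"
    by (auto intro: finite_subset[of _ "Pow A"])
  moreover have "X \<in> ?F"
    using assms by auto
  ultimately obtain B where B: "B \<in> ?F" "\<And>B'. B' \<in> ?F \<Longrightarrow> B \<subseteq> B' \<Longrightarrow> B = B'"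
    using finite_has_maximal2[of ?F X] by auto
  show thesis
  proof (rule that[of B])
    fix e assume "e \<in> A" "insert e B \<in> I"
    then show "e \<in> B"
      using B(1) B(2)[of "insert e B"] by auto
  qed (use B(1) in auto)
qed

lemma matroid_on_card_le:
  assumes M: "matroid_on E I" and "B \<in> I" "Y \<in> I"
    and max: "\<And>e. e \<in> Y \<Longrightarrow> insert e B \<in> I \<Longrightarrow> e \<in> B"
  shows "card Y \<le> card B"
proof (rule ccontr)
  assume "\<not> card Y \<le> card B"
  then obtain e where "e \<in> Y - B" "insert e B \<in> I"
    using M \<open>B \<in> I\<close> \<open>Y \<in> I\<close> unfolding matroid_on_def by (meson not_le)
  then show False
    using max by auto
qed

text \<open>Transitivity of spanning: \<open>B\<close> spans \<open>C - {e}\<close>, which spans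
  \<open>e\<close>. Otherwise a basis of \<open>C - {e} \<union> B\<close> containing
  \<open>C - {e}\<close> would be no larger than \<open>B\<close>, yet at least as large as the
  independent set \<open>insert e B\<close>.\<close>

lemma circuit_spans:
  assumes M: "matroid_on E I" and "B \<in> I" and C: "circuit E I C" "e \<in> C"
    and span: "\<And>f. f \<in> C \<Longrightarrow> f \<noteq> e \<Longrightarrow> insert f B \<in> I \<Longrightarrow> f \<in> B"
    and eB: "insert e B \<in> I"
  shows "e \<in> B"
proof (rule ccontr)
  assume "e \<notin> B"
  have fin: "finite B" and BE: "B \<subseteq> E" and CE: "C \<subseteq> E"
    using matroid_on_indepD[OF M \<open>B \<in> I\<close>] C unfolding circuit_def by blast+
  have "C - {e} \<in> I"
    using C unfolding circuit_def by auto
  then obtain X where X: "X \<in> I" "C - {e} \<subseteq> X" "X \<subseteq> C - {e} \<union> B"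
    "\<And>f. f \<in> C - {e} \<union> B \<Longrightarrow> insert f X \<in> I \<Longrightarrow> f \<in> X"
    using matroid_on_extend[OF M, of "C - {e}" "C - {e} \<union> B"] CE BE by blast
  have "card X \<le> card B"
    using X span by (intro matroid_on_card_le[OF M \<open>B \<in> I\<close>]) auto
  moreover have "card (insert e B) \<le> card X"
  proof (rule matroid_on_card_le[OF M \<open>X \<in> I\<close> eB])
    fix f assume f: "f \<in> insert e B" "insert f X \<in> I"
    show "f \<in> X"
    proof (cases "f = e")
      case True
      then have "C \<subseteq> insert f X"
        using X(2) by auto
      then show ?thesis
        using f(2) M C unfolding matroid_on_def circuit_def by blast
    qed (use f X(4) in auto)
  qed
  ultimately show False
    using \<open>e \<notin> B\<close> fin by simp
qed

text \<open>For \<open>f\<close> in \<open>C - D\<close>, extend \<open>C - {f}\<close> to a basis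
  \<open>Y\<close> of \<open>insert e X\<close>. It misses \<open>f\<close>, as it would otherwise
  contain \<open>C\<close>, and it has at least \<open>card X\<close> elements; so it is
  \<open>insert e X - {f}\<close> and contains the circuit \<open>D\<close>.\<close>

lemma circuit_unique:
  assumes M: "matroid_on E I" and "X \<in> I"
    and C: "circuit E I C" "C \<subseteq> insert e X" and D: "circuit E I D" "D \<subseteq> insert e X"
  shows "C = D"
proof (rule ccontr)
  assume "C \<noteq> D"
  have down: "\<And>X Y. X \<in> I \<Longrightarrow> Y \<subseteq> X \<Longrightarrow> Y \<in> I"
    using M unfolding matroid_on_def by blast
  have fin: "finite X" and XE: "X \<subseteq> E" and CE: "C \<subseteq> E"
    using matroid_on_indepD[OF M \<open>X \<in> I\<close>] C unfolding circuit_def by blast+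
  have "\<not> C \<subseteq> D"
    using C D \<open>C \<noteq> D\<close> unfolding circuit_def by blast
  then obtain f where f: "f \<in> C" "f \<notin> D"
    by blast
  have "\<not> C \<subseteq> X" "\<not> D \<subseteq> X"
    using C(1) D(1) down[OF \<open>X \<in> I\<close>] unfolding circuit_def by metis+
  then have "e \<in> C" "e \<in> D" "e \<notin> X"
    using C(2) D(2) by auto
  then have "f \<in> X" "e \<in> E"
    using f C CE by auto
  have "C - {f} \<in> I"
    using C f unfolding circuit_def by auto
  then obtain Y where Y: "Y \<in> I" "C - {f} \<subseteq> Y" "Y \<subseteq> insert e X"
    "\<And>g. g \<in> insert e X \<Longrightarrow> insert g Y \<in> I \<Longrightarrow> g \<in> Y"
    using matroid_on_extend[OF M, of "C - {f}" "insert e X"] C(2) XE \<open>e \<in> E\<close> by blast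
  have "f \<notin> Y"
    using Y(1,2) down[OF Y(1), of C] C unfolding circuit_def by blast
  then have sub: "Y \<subseteq> insert e X - {f}"
    using Y(3) by auto
  have "card X \<le> card Y"
    using Y(4) by (intro matroid_on_card_le[OF M Y(1) \<open>X \<in> I\<close>]) auto
  then have "Y = insert e X - {f}"
    using fin \<open>f \<in> X\<close> \<open>e \<notin> X\<close> sub by (intro card_seteq) (auto simp: card_Diff_singleton)
  then have "D \<subseteq> Y"
    using D(2) f(2) by auto
  then show False
    using down[OF Y(1)] D(1) unfolding circuit_def by blast
qed

section \<open>Boundaries modulo 2\<close>

text \<open>For a finite edge set these are the vertices of odd degree: the boundary over the field
  with two elements, where addition is symmetric difference.\<close>

definition boundary :: "'a set set \<Rightarrow> 'a set" where
  "boundary D = {v. odd (card {e \<in> D. v \<in> e})}"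

lemma odd_card_sym_diff:
  assumes "finite A" "finite B"
  shows "odd (card (sym_diff A B)) \<longleftrightarrow> odd (card A) \<noteq> odd (card B)"
proof -
  have "card (sym_diff A B) = card (A - B) + card (B - A)"
    using assms by (intro card_Un_disjoint) auto
  moreover have "card A = card (A - B) + card (A \<inter> B)" "card B = card (B - A) + card (A \<inter> B)"
    using assms by (metis card_Diff_subset_Int card_mono finite_Int inf_le1 le_add_diff_inverse2,
        metis card_Diff_subset_Int card_mono finite_Int inf_commute inf_le1 le_add_diff_inverse2)
  ultimately show ?thesis
    by auto
qed

lemma boundary_empty [simp]: "boundary {} = {}"
  by (simp add: boundary_def)

lemma boundary_singleton [simp]: "boundary {e} = e"
proof -
  have "{e'. e' = e \<and> v \<in> e'} = (if v \<in> e then {e} else {})" for v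
    by auto
  then show ?thesis
    by (auto simp: boundary_def)
qed

lemma boundary_sym_diff:
  assumes "finite A" "finite B"
  shows "boundary (sym_diff A B) = sym_diff (boundary A) (boundary B)"
proof -
  have "{e \<in> sym_diff A B. v \<in> e} = sym_diff {e \<in> A. v \<in> e} {e \<in> B. v \<in> e}" for v
    by auto
  then show ?thesis
    using assms by (auto simp: boundary_def odd_card_sym_diff)
qed

lemma boundary_insert:
  assumes "finite A" "e \<notin> A"
  shows "boundary (insert e A) = sym_diff e (boundary A)"
proof -
  have "insert e A = sym_diff {e} A"
    using assms by auto
  then show ?thesis
    using boundary_sym_diff[of "{e}" A] assms by simp
qed

lemma boundary_mem_iff:
  assumes "{e \<in> D. v \<in> e} = {a, b} \<inter> D" "a \<noteq> b"
  shows "v \<in> boundary D \<longleftrightarrow> (a \<in> D) \<noteq> (b \<in> D)"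
  unfolding boundary_def mem_Collect_eq assms(1)
  using assms(2) by (cases "a \<in> D"; cases "b \<in> D") auto

section \<open>Cycles\<close>

text \<open>This is a cycle only if \<open>k\<close> is at least 3 and \<open>f\<close> is injective
  on \<open>{..<k}\<close>.\<close>

definition cycle_of :: "nat \<Rightarrow> (nat \<Rightarrow> 'a) \<Rightarrow> 'a set set" where
  "cycle_of k f = (\<lambda>i. {f i, f (Suc i mod k)}) ` {..<k}"

lemma cycle_copies_eq:
  "cycle_copies k n = {cycle_of k f | f. inj_on f {..<k} \<and> f ` {..<k} \<subseteq> {..<n}}"
proof -
  have "(\<lambda>e. f ` e) ` cycle_edges k = cycle_of k f" for f :: "nat \<Rightarrow> nat"
  proof -
    have "cycle_edges k = (\<lambda>i. {i, Suc i mod k}) ` {..<k}"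
      by (auto simp: cycle_edges_def)
    then show ?thesis
      by (simp add: cycle_of_def image_image)
  qed
  then show ?thesis
    by (auto simp: cycle_copies_def)
qed

lemma cycle_of_Suc:
  "cycle_of (Suc m) f = insert {f m, f 0} ((\<lambda>i. {f i, f (Suc i)}) ` {..<m})"
  by (auto simp: cycle_of_def lessThan_Suc)

lemma mod_Suc_cases:
  assumes "i < k"
  shows "Suc i mod k = (if Suc i = k then 0 else Suc i)"
  using assms by auto

text \<open>Equal edges with different indices would make each index the cyclic successor of the
  other, which is impossible for \<open>k\<close> at least 3.\<close>

lemma cycle_index_inj:
  assumes "3 \<le> k" "inj_on f {..<k}"
  shows "inj_on (\<lambda>i. {f i, f (Suc i mod k)}) {..<k}"
proof (rule inj_onI)
  fix i j assume ij: "i \<in> {..<k}" "j \<in> {..<k}"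
    and eq: "{f i, f (Suc i mod k)} = {f j, f (Suc j mod k)}"
  have "Suc i mod k < k" "Suc j mod k < k"
    using assms by auto
  then have "i = j \<or> (i = Suc j mod k \<and> Suc i mod k = j)"
    using ij eq assms(2) by (auto simp: doubleton_eq_iff inj_on_eq_iff)
  then show "i = j"
    using ij assms(1) by (auto simp: mod_Suc_cases split: if_splits)
qed

lemma card_cycle_of:
  assumes "3 \<le> k" "inj_on f {..<k}"
  shows "card (cycle_of k f) = k"
  using cycle_index_inj[OF assms] by (simp add: cycle_of_def card_image)

text \<open>Naming the vertex as the cyclic successor of \<open>i\<close> gives its two edges the
  indices \<open>i\<close> and \<open>Suc i mod k\<close>, with no predecessor modulo
  \<open>k\<close>.\<close>

lemma cycle_of_incident:
  assumes "3 \<le> k" "inj_on f {..<k}" "i < k"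
  shows "{e \<in> cycle_of k f. f (Suc i mod k) \<in> e} =
    {{f i, f (Suc i mod k)}, {f (Suc i mod k), f (Suc (Suc i mod k) mod k)}}"
proof -
  let ?j = "Suc i mod k"
  have "?j < k"
    using assms by auto
  have "f ?j \<in> {f l, f (Suc l mod k)} \<longleftrightarrow> l = i \<or> l = ?j" if "l < k" for l
  proof -
    have "Suc l mod k < k"
      using assms by auto
    then have "f ?j \<in> {f l, f (Suc l mod k)} \<longleftrightarrow> ?j = l \<or> ?j = Suc l mod k"
      using that \<open>?j < k\<close> assms(2) by (auto simp: inj_on_eq_iff)
    also have "\<dots> \<longleftrightarrow> l = i \<or> l = ?j"
      using that assms by (auto simp: mod_Suc_cases split: if_splits)
    finally show ?thesis .
  qed
  then show ?thesis
    using \<open>i < k\<close> \<open>?j < k\<close> unfolding cycle_of_def by blast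
qed

lemma cycle_of_boundary_mem_iff:
  assumes "3 \<le> k" "inj_on f {..<k}" "i < k" "D \<subseteq> cycle_of k f"
  shows "f (Suc i mod k) \<in> boundary D \<longleftrightarrow>
    ({f i, f (Suc i mod k)} \<in> D) \<noteq> ({f (Suc i mod k), f (Suc (Suc i mod k) mod k)} \<in> D)"
proof (rule boundary_mem_iff)
  show "{e \<in> D. f (Suc i mod k) \<in> e} =
    {{f i, f (Suc i mod k)}, {f (Suc i mod k), f (Suc (Suc i mod k) mod k)}} \<inter> D"
    using cycle_of_incident[OF assms(1-3)] assms(4) by blast
  have "i \<noteq> Suc i mod k" "Suc i mod k < k"
    using assms by (auto simp: mod_Suc_cases split: if_splits)
  then show "{f i, f (Suc i mod k)} \<noteq> {f (Suc i mod k), f (Suc (Suc i mod k) mod k)}"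
    using inj_onD[OF cycle_index_inj[OF assms(1,2)]] assms(3) by blast
qed

lemma boundary_cycle_of:
  assumes "3 \<le> k" "inj_on f {..<k}"
  shows "boundary (cycle_of k f) = {}"
proof (rule ccontr)
  assume "boundary (cycle_of k f) \<noteq> {}"
  then obtain v where v: "v \<in> boundary (cycle_of k f)"
    by blast
  then have "{e \<in> cycle_of k f. v \<in> e} \<noteq> {}"
    unfolding boundary_def by (metis (mono_tags, lifting) card.empty even_zero mem_Collect_eq)
  then obtain l where "l < k" "v = f l \<or> v = f (Suc l mod k)"
    by (auto simp: cycle_of_def)
  moreover from this have "Suc l mod k < k"
    by simp
  ultimately obtain j where j: "j < k" "v = f j"
    by blast
  \<comment> \<open>The cyclic predecessor of \<open>j\<close> is \<open>k - 1\<close> for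
    \<open>j = 0\<close> and \<open>j - 1\<close> otherwise.\<close>
  then obtain i where "i < k" "j = Suc i mod k"
    using assms by (cases j) (auto intro: that[of "k - 1"] that[of "j - 1"])
  moreover from this have "{f i, f j} \<in> cycle_of k f" "{f j, f (Suc j mod k)} \<in> cycle_of k f"
    using j by (auto simp: cycle_of_def)
  ultimately show False
    using cycle_of_boundary_mem_iff[OF assms, of i "cycle_of k f"] v j by auto
qed

text \<open>At each vertex, parity puts both or neither of its two cycle edges into
  \<open>D\<close>, so membership in \<open>D\<close> propagates around the cycle.\<close>

lemma cycle_of_subset_boundary_empty:
  assumes "3 \<le> k" "inj_on f {..<k}" "D \<subseteq> cycle_of k f" "D \<noteq> {}" "boundary D = {}"
  shows "D = cycle_of k f"
proof -
  let ?e = "\<lambda>i. {f i, f (Suc i mod k)}"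
  have step: "?e i \<in> D \<longleftrightarrow> ?e (Suc i mod k) \<in> D" if "i < k" for i
    using cycle_of_boundary_mem_iff[OF assms(1,2) that assms(3)] assms(5) by auto
  have "?e i \<in> D \<longleftrightarrow> ?e 0 \<in> D" if "i < k" for i
    using that
  proof (induction i)
    case (Suc i)
    then show ?case
      using step[of i] by (simp only: mod_less Suc_lessD)
  qed simp
  then show ?thesis
    using assms(3,4) unfolding cycle_of_def by blast
qed

lemma cycle_of_subset_complete_edges:
  assumes "2 \<le> k" "inj_on f {..<k}" "f ` {..<k} \<subseteq> {..<n}"
  shows "cycle_of k f \<subseteq> complete_edges n"
proof
  fix e assume "e \<in> cycle_of k f"
  then obtain i where i: "i < k" "e = {f i, f (Suc i mod k)}"
    by (auto simp: cycle_of_def)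
  have "Suc i mod k < k" "i \<noteq> Suc i mod k"
    using assms(1) i by (auto simp: mod_Suc_cases split: if_splits)
  then have "f i \<noteq> f (Suc i mod k)" "f i < n" "f (Suc i mod k) < n"
    using i(1) assms(2,3) inj_on_eq_iff[of f "{..<k}" i "Suc i mod k"] by blast+
  then show "e \<in> complete_edges n"
    using i by (simp add: complete_edges_def)
qed

lemma finite_complete_edges: "finite (complete_edges n)"
  unfolding complete_edges_def by (rule finite_subset[of _ "Pow {..<n}"]) auto

section \<open>The graphic matroid and the sparse paving matroid\<close>

text \<open>These are the forests, described as linearly independent sets of edges over the field
  with two elements: a nonempty edge set with all degrees even contains a cycle.\<close>

definition graphic_indep :: "nat \<Rightarrow> nat set set set" where
  "graphic_indep n = {X. X \<subseteq> complete_edges n \<and> (\<forall>D \<subseteq> X. boundary D = {} \<longrightarrow> D = {})}"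

text \<open>Exchange holds because an independent \<open>Y\<close> has \<open>2 ^ card Y\<close> different boundaries of subsets,
  while \<open>X\<close> can produce at most \<open>2 ^ card X\<close> of them.\<close>

lemma matroid_on_graphic_indep: "matroid_on (complete_edges n) (graphic_indep n)"
proof -
  have "\<exists>e \<in> Y - X. insert e X \<in> graphic_indep n"
    if X: "X \<in> graphic_indep n" and Y: "Y \<in> graphic_indep n" and less: "card X < card Y" for X Y
  proof (rule ccontr)
    assume no: "\<not> (\<exists>e \<in> Y - X. insert e X \<in> graphic_indep n)"
    have fin: "finite X" "finite Y"
      using X Y finite_subset[OF _ finite_complete_edges] unfolding graphic_indep_def by auto
    \<comment> \<open>If \<open>insert e X\<close> contains a nonempty \<open>D\<close> with empty
      boundary, then \<open>e\<close> lies in \<open>D\<close>, and \<open>D - {e}\<close> is a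
      subset of \<open>X\<close> with boundary \<open>e\<close>.\<close>
    have span1: "e \<in> boundary ` Pow X" if "e \<in> Y" for e
    proof (cases "e \<in> X")
      case True
      then show ?thesis
        by (intro image_eqI[of _ _ "{e}"]) auto
    next
      case False
      then have "insert e X \<notin> graphic_indep n"
        using no that by auto
      moreover have "insert e X \<subseteq> complete_edges n"
        using X Y \<open>e \<in> Y\<close> unfolding graphic_indep_def by auto
      ultimately obtain D where D: "D \<subseteq> insert e X" "boundary D = {}" "D \<noteq> {}"
        unfolding graphic_indep_def mem_Collect_eq by metis
      then have "\<not> D \<subseteq> X"
        using X unfolding graphic_indep_def mem_Collect_eq by metis
      then have "e \<in> D"
        using D(1) by auto
      then have "boundary D = sym_diff e (boundary (D - {e}))"
        using boundary_insert[of "D - {e}" e] fin(1) D(1) finite_subset[of D "insert e X"]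
        by (simp add: insert_absorb)
      then have "e = boundary (D - {e})"
        using D(2) by auto
      then show ?thesis
        using D(1) by blast
    qed
    have "boundary D \<in> boundary ` Pow X" if "D \<subseteq> Y" for D
      using finite_subset[OF that fin(2)] that
    proof (induction D rule: finite_induct)
      case (insert e D)
      then obtain A B where AB: "A \<subseteq> X" "boundary D = boundary A" "B \<subseteq> X" "e = boundary B"
        using span1[of e] by auto
      have "boundary (insert e D) = boundary (sym_diff B A)"
        using AB fin(1) finite_subset[of _ X] insert.hyps boundary_insert[of D e]
        by (simp add: boundary_sym_diff)
      then show ?case
        using AB by blast
    qed (auto intro: image_eqI[of _ _ "{}"])
    then have sub: "boundary ` Pow Y \<subseteq> boundary ` Pow X"
      by auto
    \<comment> \<open>By additivity, two subsets with equal boundaries have a symmetric difference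
      with empty boundary.\<close>
    have "inj_on boundary (Pow Y)"
    proof (rule inj_onI)
      fix A B assume AB: "A \<in> Pow Y" "B \<in> Pow Y" "boundary A = boundary B"
      then have "boundary (sym_diff A B) = {}"
        using fin(2) finite_subset[of _ Y] by (auto simp: boundary_sym_diff)
      moreover have "sym_diff A B \<subseteq> Y"
        using AB by auto
      ultimately have "sym_diff A B = {}"
        using Y unfolding graphic_indep_def by blast
      then show "A = B"
        by auto
    qed
    then have "2 ^ card Y = card (boundary ` Pow Y)"
      using fin by (simp add: card_image card_Pow)
    also have "\<dots> \<le> card (boundary ` Pow X)"
      using sub fin by (intro card_mono) auto
    also have "\<dots> \<le> 2 ^ card X"
      using fin card_image_le[of "Pow X" boundary] by (simp add: card_Pow)
    finally show False
      using less by simp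
  qed
  moreover have "Y \<in> graphic_indep n" if "X \<in> graphic_indep n" "Y \<subseteq> X" for X Y
    using that unfolding graphic_indep_def by blast
  moreover have "X \<subseteq> complete_edges n" if "X \<in> graphic_indep n" for X
    using that by (simp add: graphic_indep_def)
  moreover have "{} \<in> graphic_indep n"
    by (simp add: graphic_indep_def)
  ultimately show ?thesis
    by (intro matroid_onI finite_complete_edges) blast+
qed

lemma Ck_matroid_on_graphic_indep:
  assumes "3 \<le> k"
  shows "Ck_matroid_on k n (graphic_indep n)"
proof -
  have "circuit (complete_edges n) (graphic_indep n) C" if C: "C \<in> cycle_copies k n" for C
  proof -
    obtain f where f: "inj_on f {..<k}" "f ` {..<k} \<subseteq> {..<n}" "C = cycle_of k f"
      using C unfolding cycle_copies_eq by blast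
    have CE: "C \<subseteq> complete_edges n"
      using cycle_of_subset_complete_edges f assms by simp
    have "C \<noteq> {}"
      using card_cycle_of[OF assms f(1)] f(3) assms by auto
    then have "C \<notin> graphic_indep n"
      using boundary_cycle_of[OF assms f(1)] f(3) by (auto simp: graphic_indep_def)
    moreover have "D \<in> graphic_indep n" if "D \<subset> C" for D
      using that CE cycle_of_subset_boundary_empty[OF assms f(1)] f(3)
      by (auto simp: graphic_indep_def)
    ultimately show ?thesis
      using CE by (auto simp: circuit_def)
  qed
  then show ?thesis
    by (simp add: Ck_matroid_on_def matroid_on_graphic_indep)
qed

text \<open>Each leaf lies on only one edge of the star, so a leaf covered by a nonempty subset is
  in its boundary. The star is the witness for the rank of the graphic matroid.\<close>

lemma star_in_graphic_indep: "(\<lambda>i. {0, i}) ` {1..<n} \<in> graphic_indep n"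
proof -
  have "D = {}" if D: "D \<subseteq> (\<lambda>i. {0, i}) ` {1..<n}" "boundary D = {}" for D
  proof (rule ccontr)
    assume "D \<noteq> {}"
    then obtain i where i: "i \<in> {1..<n}" "{0, i} \<in> D"
      using D(1) by blast
    then have "{e \<in> D. i \<in> e} = {{0, i}}"
      using D(1) by auto
    then have "i \<in> boundary D"
      by (simp add: boundary_def)
    then show False
      using D(2) by simp
  qed
  then show ?thesis
    by (auto simp: graphic_indep_def complete_edges_def card_insert_if)
qed

lemma card_star: "card ((\<lambda>i. {0, i}) ` {1..<n::nat}) = n - 1"
  by (subst card_image) (auto simp: inj_on_def doubleton_eq_iff)

section \<open>The sparse paving matroid\<close>

definition paving_indep :: "nat \<Rightarrow> nat \<Rightarrow> nat set set set" where
  "paving_indep k n = {X. X \<subseteq> complete_edges n \<and> card X \<le> k \<and> X \<notin> cycle_copies k n}"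

lemma cycle_copies_D:
  assumes "3 \<le> k" "C \<in> cycle_copies k n"
  shows "C \<subseteq> complete_edges n" "card C = k" "boundary C = {}"
proof -
  obtain f where "inj_on f {..<k}" "f ` {..<k} \<subseteq> {..<n}" "C = cycle_of k f"
    using assms unfolding cycle_copies_eq by blast
  then show "C \<subseteq> complete_edges n" "card C = k" "boundary C = {}"
    using assms cycle_of_subset_complete_edges card_cycle_of boundary_cycle_of by simp_all
qed

text \<open>Exchange could fail only if every edge of \<open>Y - X\<close> completed
  \<open>X\<close> to a \<open>k\<close>-cycle. There is at most one such edge \<open>e\<close>, so
  \<open>Y\<close> would be the cycle \<open>insert e X\<close>.\<close>

lemma matroid_on_paving_indep:
  assumes "3 \<le> k"
  shows "matroid_on (complete_edges n) (paving_indep k n)"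
proof -
  note cyc = cycle_copies_D[OF assms]
  have fin: "finite X" if "X \<subseteq> complete_edges n" for X
    using that finite_subset finite_complete_edges by blast
  have "\<exists>e \<in> Y - X. insert e X \<in> paving_indep k n"
    if X: "X \<in> paving_indep k n" and Y: "Y \<in> paving_indep k n" and less: "card X < card Y" for X Y
  proof (rule ccontr)
    assume no: "\<not> (\<exists>e \<in> Y - X. insert e X \<in> paving_indep k n)"
    have XY: "X \<subseteq> complete_edges n" "Y \<subseteq> complete_edges n" "card Y \<le> k" "finite X" "finite Y"
      using X Y fin by (auto simp: paving_indep_def)
    have cycle: "insert e X \<in> cycle_copies k n" if "e \<in> Y - X" for e
      using no that XY less by (auto simp: paving_indep_def)
    \<comment> \<open>The edge completing \<open>X\<close> to a cycle is determined by \<open>X\<close>: it is the boundary of \<open>X\<close>.\<close>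
    have e: "e = boundary X" if "e \<in> Y - X" for e
      using cyc(3)[OF cycle[OF that]] boundary_insert[of X e] XY that by auto
    have "\<not> Y \<subseteq> X"
      using less XY card_mono[of X Y] by auto
    then obtain e where "e \<in> Y - X"
      by auto
    then have "Y \<subseteq> insert e X"
      using e by auto
    moreover have "card (insert e X) \<le> card Y"
      using less XY \<open>e \<in> Y - X\<close> by simp
    ultimately have "Y = insert e X"
      using XY by (intro card_seteq) auto
    then show False
      using cycle[OF \<open>e \<in> Y - X\<close>] Y by (simp add: paving_indep_def)
  qed
  moreover have "Y \<in> paving_indep k n" if "X \<in> paving_indep k n" "Y \<subseteq> X" for X Y
  proof -
    have "finite X" "card X \<le> k" "X \<subseteq> complete_edges n" "X \<notin> cycle_copies k n"
      using that fin by (auto simp: paving_indep_def)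
    moreover from this have "card Y \<le> card X"
      using that card_mono by blast
    moreover have "card Y < card X" if "Y \<noteq> X"
      using that \<open>Y \<subseteq> X\<close> \<open>finite X\<close> by (auto intro: psubset_card_mono)
    ultimately show ?thesis
      using that cyc(2)[of Y] by (cases "Y = X") (auto simp: paving_indep_def)
  qed
  moreover have "{} \<in> paving_indep k n"
    using cyc(2)[of "{}"] assms by (auto simp: paving_indep_def)
  moreover have "X \<subseteq> complete_edges n" if "X \<in> paving_indep k n" for X
    using that by (simp add: paving_indep_def)
  ultimately show ?thesis
    by (intro matroid_onI finite_complete_edges) blast+
qed

lemma Ck_matroid_on_paving_indep:
  assumes "3 \<le> k"
  shows "Ck_matroid_on k n (paving_indep k n)"
proof -
  note cyc = cycle_copies_D[OF assms]
  have "circuit (complete_edges n) (paving_indep k n) C" if C: "C \<in> cycle_copies k n" for C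
  proof -
    have "finite C"
      using cyc(1)[OF C] finite_subset finite_complete_edges by blast
    have "D \<in> paving_indep k n" if "D \<subset> C" for D
    proof -
      have "card D < k"
        using psubset_card_mono[OF \<open>finite C\<close> that] cyc(2)[OF C] by simp
      then show ?thesis
        using that cyc(1)[OF C] cyc(2)[of D n] by (auto simp: paving_indep_def)
    qed
    then show ?thesis
      using C cyc(1)[OF C] by (auto simp: circuit_def paving_indep_def)
  qed
  then show ?thesis
    using matroid_on_paving_indep[OF assms] by (simp add: Ck_matroid_on_def)
qed

section \<open>Absence of a common upper bound\<close>

lemma Ck_matroid_on_circuit:
  assumes "Ck_matroid_on (Suc m) n I" "inj_on f {..m}" "f ` {..m} \<subseteq> {..<n}"
  shows "circuit (complete_edges n) I (insert {f m, f 0} ((\<lambda>i. {f i, f (Suc i)}) ` {..<m}))"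
proof -
  have "cycle_of (Suc m) f \<in> cycle_copies (Suc m) n"
    using assms(2,3) by (auto simp: cycle_copies_eq lessThan_Suc_atMost)
  then show ?thesis
    using assms(1) by (simp add: Ck_matroid_on_def cycle_of_Suc)
qed

text \<open>If \<open>B\<close> spans the complete graph on \<open>{..<k - 1}\<close> and all edges
  from outside vertices to 0, it spans all of \<open>E(K_n)\<close>: each other edge closes a
  \<open>k\<close>-cycle of edges already spanned. Edges from an outside to an inside vertex come
  first, then those between outside vertices.\<close>

lemma Ck_matroid_on_card_le:
  assumes M: "Ck_matroid_on k n I" and k: "5 \<le> k" "k \<le> n" and B: "B \<in> I"
    and inner: "\<And>e. e \<in> complete_edges (k - 1) \<Longrightarrow> insert e B \<in> I \<Longrightarrow> e \<in> B"
    and outer: "\<And>v. k - 1 \<le> v \<Longrightarrow> v < n \<Longrightarrow> insert {v, 0} B \<in> I \<Longrightarrow> {v, 0} \<in> B"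
    and "Y \<in> I"
  shows "card Y \<le> card B"
proof -
  define m where "m = k - 1"
  then have km: "k = Suc m" "4 \<le> m" "m < n"
    using k by auto
  have mat: "matroid_on (complete_edges n) I"
    using M by (simp add: Ck_matroid_on_def)
  have inner': "e \<in> B" if "e = {x, y}" "x < m" "y < m" "x \<noteq> y" "insert e B \<in> I" for e x y
    using inner[of e] that m_def by (auto simp: complete_edges_def)
  have cross: "{v, x} \<in> B" if v: "m \<le> v" "v < n" and x: "x < m" "insert {v, x} B \<in> I" for v x
  proof (cases "x = 0")
    case True
    then show ?thesis
      using outer[of v] v x m_def by auto
  next
    case False
    \<comment> \<open>Swapping \<open>x\<close> and \<open>m - 1\<close> yields a Hamiltonian path
      of \<open>{..<m}\<close> from 0 to \<open>x\<close>, which closes up through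
      \<open>v\<close>.\<close>
    define f where "f = (\<lambda>i. if i = m then v else if i = x then m - 1 else if i = m - 1 then x else i)"
    have f: "inj_on f {..m}" "f ` {..m} \<subseteq> {..<n}"
      using v x km by (auto simp: f_def inj_on_def split: if_splits)
    have fm: "f m = v" "f 0 = 0" "f (m - 1) = x" and fi: "\<And>i. i < m \<Longrightarrow> f i < m"
      using False x km by (auto simp: f_def)
    show ?thesis
    proof (rule circuit_spans[OF mat B Ck_matroid_on_circuit[OF M[unfolded km(1)] f] _ _ x(2)])
      show "{v, x} \<in> insert {f m, f 0} ((\<lambda>i. {f i, f (Suc i)}) ` {..<m})"
        using fm km by (intro insertI2 image_eqI[of _ _ "m - 1"]) auto
      fix e assume e: "e \<in> insert {f m, f 0} ((\<lambda>i. {f i, f (Suc i)}) ` {..<m})" "e \<noteq> {v, x}"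
        "insert e B \<in> I"
      then consider "e = {v, 0}" | i where "i < m" "e = {f i, f (Suc i)}"
        using fm by auto
      then show "e \<in> B"
      proof cases
        case 1
        then show ?thesis
          using outer[of v] v e m_def by auto
      next
        case (2 i)
        then have "Suc i < m"
          using e(2) fm km by (cases "i = m - 1") auto
        moreover from this have "f i \<noteq> f (Suc i)"
          using f(1) by (auto simp: inj_on_eq_iff)
        ultimately show ?thesis
          using inner'[OF 2(2)] fi e(3) by auto
      qed
    qed
  qed
  have far: "{u, v} \<in> B" if uv: "m \<le> u" "u < n" "m \<le> v" "v < n" "u \<noteq> v" "insert {u, v} B \<in> I" for u v
  proof -
    \<comment> \<open>The cycle is 0, 1, ..., \<open>m - 2\<close>, \<open>u\<close>,
      \<open>v\<close>; its edge \<open>{m - 2, u}\<close> is covered by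
      \<open>cross\<close>.\<close>
    define f where "f = (\<lambda>i. if i = m then v else if i = m - 1 then u else i)"
    have f: "inj_on f {..m}" "f ` {..m} \<subseteq> {..<n}"
      using uv km by (auto simp: f_def inj_on_def split: if_splits)
    have fm: "f m = v" "f 0 = 0" "f (m - 1) = u" and fi: "\<And>i. i < m - 1 \<Longrightarrow> f i = i"
      using km by (auto simp: f_def)
    show ?thesis
    proof (rule circuit_spans[OF mat B Ck_matroid_on_circuit[OF M[unfolded km(1)] f] _ _ uv(6)])
      show "{u, v} \<in> insert {f m, f 0} ((\<lambda>i. {f i, f (Suc i)}) ` {..<m})"
        using fm km by (intro insertI2 image_eqI[of _ _ "m - 1"]) auto
      fix e assume e: "e \<in> insert {f m, f 0} ((\<lambda>i. {f i, f (Suc i)}) ` {..<m})" "e \<noteq> {u, v}"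
        "insert e B \<in> I"
      then consider "e = {v, 0}" | i where "i < m" "e = {f i, f (Suc i)}"
        using fm by auto
      then show "e \<in> B"
      proof cases
        case 1
        then show ?thesis
          using outer[of v] uv e m_def by auto
      next
        case (2 i)
        then have "i < m - 1"
          using e(2) fm km by (cases "i = m - 1") auto
        show ?thesis
        proof (cases "Suc i = m - 1")
          case True
          then have "e = {u, i}"
            using 2 fm fi[of i] by auto
          then show ?thesis
            using cross[of u i] uv 2 e by auto
        next
          case False
          then show ?thesis
            using inner'[of e i "Suc i"] \<open>i < m - 1\<close> 2 fi[of i] fi[of "Suc i"] e by auto
        qed
      qed
    qed
  qed
  show ?thesis
  proof (rule matroid_on_card_le[OF mat B \<open>Y \<in> I\<close>])
    fix e assume e: "e \<in> Y" "insert e B \<in> I"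
    then have "e \<in> complete_edges n"
      using \<open>Y \<in> I\<close> mat unfolding matroid_on_def by auto
    then obtain x y where xy: "e = {x, y}" "x \<noteq> y" "x < n" "y < n"
      by (auto simp: complete_edges_def card_2_iff)
    then show "e \<in> B"
      using inner'[of e x y] cross[of x y] cross[of y x] far[of x y] e(2)
      by (cases "x < m"; cases "y < m") (auto simp: insert_commute)
  qed
qed

text \<open>The set has \<open>(m - 1) + 2\<close> edges, which is the size of a cycle, but vertex 1
  has the three neighbours 0, 2 and 3 and thus odd degree.\<close>

lemma two_paths_in_paving_indep:
  assumes "4 \<le> m" "m \<le> n"
  shows "{{0, 2}, {1, 3}} \<union> (\<lambda>i. {i, Suc i}) ` {..<m - 1} \<in> paving_indep (Suc m) n"
    (is "?A \<union> ?P \<in> _")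
proof -
  have mem: "{a, b} \<in> ?P \<longleftrightarrow> a < m - 1 \<and> b = Suc a \<or> b < m - 1 \<and> a = Suc b" for a b
    unfolding image_iff Bex_def doubleton_eq_iff lessThan_iff by metis
  have "inj_on (\<lambda>i. {i, Suc i}) {..<m - 1}"
    by (rule inj_onI) (auto simp: doubleton_eq_iff)
  then have "card ?P = m - 1"
    by (simp add: card_image)
  moreover have "card ?A = 2"
    by (simp add: doubleton_eq_iff)
  moreover have "?A \<inter> ?P = {}"
    using mem[of 0 2] mem[of 1 3] by simp
  ultimately have "card (?A \<union> ?P) = Suc m"
    using assms by (subst card_Un_disjoint) auto
  moreover have "?A \<union> ?P \<subseteq> complete_edges n"
    using assms by (auto simp: complete_edges_def card_insert_if)
  moreover have "?A \<union> ?P \<notin> cycle_copies (Suc m) n"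
  proof
    assume "?A \<union> ?P \<in> cycle_copies (Suc m) n"
    then have "boundary (?A \<union> ?P) = {}"
      using cycle_copies_D(3)[of "Suc m"] assms by auto
    moreover have "{e \<in> ?A \<union> ?P. 1 \<in> e} = {{1, 3}, {0, 1}, {1, 2}}"
    proof -
      have *: "{e \<in> Q. v \<in> e} = {a, b}"
        if "a \<in> Q" "b \<in> Q" "v \<in> a" "v \<in> b" "\<And>e. e \<in> Q \<Longrightarrow> v \<in> e \<Longrightarrow> e = a \<or> e = b"
        for Q :: "nat set set" and v a b
        using that by blast
      have "{e \<in> ?P. 1 \<in> e} = {{0, 1}, {1, 2}}"
      proof (rule *)
        show "{0, 1} \<in> ?P" "{1, 2} \<in> ?P"
          using mem[of 0 1] mem[of 1 2] assms by auto
        show "e = {0, 1} \<or> e = {1, 2}" if "e \<in> ?P" "1 \<in> e" for e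
          using that by (auto simp: numeral_2_eq_2)
      qed auto
      moreover have "{e \<in> ?A. 1 \<in> e} = {{1, 3}}"
        by auto
      moreover have "{e \<in> ?A \<union> ?P. 1 \<in> e} = {e \<in> ?A. 1 \<in> e} \<union> {e \<in> ?P. 1 \<in> e}"
        by (simp only: Un_iff conj_disj_distribR Collect_disj_eq)
      ultimately show ?thesis
        by (simp only: Un_insert_left Un_empty_left)
    qed
    moreover have "card {{1, 3}, {0, 1}, {1, 2::nat}} = 3"
      by (simp add: doubleton_eq_iff)
    moreover have "odd (3 :: nat)"
      by simp
    ultimately have "1 \<in> boundary (?A \<union> ?P)"
      unfolding boundary_def mem_Collect_eq by metis
    with \<open>boundary (?A \<union> ?P) = {}\<close> show False
      by blast
  qed
  ultimately show ?thesis
    by (simp add: paving_indep_def)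
qed

lemma no_common_upper_bound:
  assumes k: "5 \<le> k" and n: "((k - 1) choose 2) + 2 \<le> n"
    and M: "Ck_matroid_on k n I" and G: "graphic_indep n \<subseteq> I" and P: "paving_indep k n \<subseteq> I"
  shows False
proof -
  define m where "m = k - 1"
  have km: "k = Suc m" "4 \<le> m"
    using k m_def by auto
  \<comment> \<open>These estimates give \<open>m < n\<close>, so that a vertex outside
    \<open>{..<m}\<close> exists.\<close>
  have "2 * (m - 1) \<le> m * (m - 1)"
    using km(2) by (intro mult_right_mono) auto
  then have "2 * (m - 1) div 2 \<le> m * (m - 1) div 2"
    by (rule div_le_mono)
  then have "m - 1 \<le> m choose 2"
    by (simp add: choose_two)
  then have "m < n"
    using n[folded m_def] by linarith
  have mat: "matroid_on (complete_edges n) I"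
    using M by (simp add: Ck_matroid_on_def)
  have down: "\<And>X Y. X \<in> I \<Longrightarrow> Y \<subseteq> X \<Longrightarrow> Y \<in> I"
    using mat unfolding matroid_on_def by blast
  define PP where "PP = {{0, 2}, {1, 3}} \<union> (\<lambda>i. {i, Suc i}) ` {..<m - 1}"
  have "PP \<in> I"
    using two_paths_in_paving_indep[of m n] km \<open>m < n\<close> P PP_def by auto
  \<comment> \<open>The instance \<open>n = m\<close> of the lemma records that only vertices below
    \<open>m\<close> occur.\<close>
  moreover have "PP \<subseteq> complete_edges m"
    using two_paths_in_paving_indep[of m m] km PP_def by (simp add: paving_indep_def)
  moreover have "complete_edges m \<subseteq> complete_edges n"
    using \<open>m < n\<close> by (auto simp: complete_edges_def)
  \<comment> \<open>A basis of the complete graph on \<open>{..<m}\<close> that contains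
    \<open>PP\<close>: an edge not spanned by it can be added to \<open>PP\<close> without losing
    independence.\<close>
  ultimately obtain B where B: "B \<in> I" "PP \<subseteq> B" "B \<subseteq> complete_edges m"
    "\<And>e. e \<in> complete_edges m \<Longrightarrow> insert e B \<in> I \<Longrightarrow> e \<in> B"
    using matroid_on_extend[OF mat] by metis
  have "card B \<le> card (complete_edges m)"
    using B(3) finite_complete_edges card_mono by blast
  also have "\<dots> = m choose 2"
    using n_subsets[of "{..<m}" 2] by (simp add: complete_edges_def)
  also have "\<dots> < n - 1"
    using n[folded m_def] by linarith
  finally have "card B < n - 1" .
  then have "\<not> card ((\<lambda>i. {0, i}) ` {1..<n}) \<le> card B"
    by (simp only: card_star not_le)
  then obtain v where v: "m \<le> v" "v < n" "insert {v, 0} B \<in> I"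
    using Ck_matroid_on_card_le[OF M k _ B(1), folded m_def, OF _ B(4)]
      star_in_graphic_indep[of n] G km(1) \<open>m < n\<close>
    by (metis Suc_leI subsetD)
  define X where "X = insert {v, 0} PP"
  have "X \<in> I"
    unfolding X_def by (intro down[OF v(3)] insert_mono B(2))
  \<comment> \<open>The two cycles are 0, 1, 2, 3, ..., \<open>m - 1\<close>, \<open>v\<close> and
    0, 2, 1, 3, ..., \<open>m - 1\<close>, \<open>v\<close>. As \<open>m\<close> is at least 4,
    swapping 1 and 2 fixes \<open>m - 1\<close>, so \<open>{m - 1, v}\<close> is the only edge of
    either cycle outside \<open>X\<close>.\<close>
  define f where "f = (\<lambda>i. if i = m then v else i)"
  define g where "g = (\<lambda>i. if i = m then v else if i = 1 then 2 else if i = 2 then 1 else i)"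
  have "inj_on f {..m}" "f ` {..m} \<subseteq> {..<n}" "inj_on g {..m}" "g ` {..m} \<subseteq> {..<n}"
    using v km by (auto simp: f_def g_def inj_on_def split: if_splits)
  note circ = Ck_matroid_on_circuit[OF M[unfolded km(1)] this(1,2)]
    Ck_matroid_on_circuit[OF M[unfolded km(1)] this(3,4)]
  have X: "{v, 0} \<in> X" "{0, 2} \<in> X" "{1, 3} \<in> X" "\<And>i. Suc i < m \<Longrightarrow> {i, Suc i} \<in> X"
    unfolding X_def PP_def by auto
  have "{f i, f (Suc i)} \<in> insert {m - 1, v} X" if "i < m" for i
    using that X(4)[of i] by (cases "Suc i = m") (auto simp: f_def)
  moreover have "{f m, f 0} \<in> insert {m - 1, v} X"
    using X(1) km(2) by (simp add: f_def)
  ultimately have subf: "insert {f m, f 0} ((\<lambda>i. {f i, f (Suc i)}) ` {..<m}) \<subseteq> insert {m - 1, v} X"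
    by blast
  have "{g i, g (Suc i)} \<in> insert {m - 1, v} X" if "i < m" for i
  proof -
    consider "i = 0" | "i = 1" | "i = 2" | "3 \<le> i" "Suc i < m" | "3 \<le> i" "Suc i = m"
      using \<open>i < m\<close> by linarith
    then show ?thesis
    proof cases
      case 1
      then show ?thesis
        using X(2) km(2) by (simp add: g_def)
    next
      case 2
      then have "{g i, g (Suc i)} = {1, Suc 1}"
        using km(2) by (auto simp: g_def)
      then show ?thesis
        using X(4)[of 1] km(2) by simp
    next
      case 3
      then have "{g i, g (Suc i)} = {1, 3}"
        using km(2) by (simp add: g_def)
      then show ?thesis
        using X(3) by simp
    next
      case 4
      then have "{g i, g (Suc i)} = {i, Suc i}"
        by (simp add: g_def)
      then show ?thesis
        using X(4) 4 by simp
    next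
      case 5
      then have "g i = m - 1" "g (Suc i) = v"
        by (auto simp: g_def)
      then show ?thesis
        by simp
    qed
  qed
  moreover have "{g m, g 0} \<in> insert {m - 1, v} X"
    using X(1) km(2) by (simp add: g_def)
  ultimately have subg: "insert {g m, g 0} ((\<lambda>i. {g i, g (Suc i)}) ` {..<m}) \<subseteq> insert {m - 1, v} X"
    by blast
  have "insert {f m, f 0} ((\<lambda>i. {f i, f (Suc i)}) ` {..<m}) =
    insert {g m, g 0} ((\<lambda>i. {g i, g (Suc i)}) ` {..<m})"
    by (rule circuit_unique[OF mat \<open>X \<in> I\<close> circ(1) subf circ(2) subg])
  \<comment> \<open>The edge \<open>{0, 2}\<close> tells the two cycles apart.\<close>
  moreover have "{0, 2} \<in> insert {g m, g 0} ((\<lambda>i. {g i, g (Suc i)}) ` {..<m})"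
    using km by (intro insertI2 image_eqI[of _ _ 0]) (auto simp: g_def)
  moreover have "{0, 2} \<notin> insert {f m, f 0} ((\<lambda>i. {f i, f (Suc i)}) ` {..<m})"
    using km v by (auto simp: f_def doubleton_eq_iff split: if_splits)
  ultimately show False
    by simp
qed

section \<open>Maximal matroids and the conclusion\<close>

lemma Ck_matroid_on_below_maximal:
  assumes "Ck_matroid_on k n I"
  obtains J where "maximal_Ck_matroid_on k n J" "I \<subseteq> J"
proof -
  \<comment> \<open>Only finitely many families live on the finite ground set, so a maximal one
    above \<open>I\<close> exists.\<close>
  have "Collect (Ck_matroid_on k n) \<subseteq> Pow (Pow (complete_edges n))"
    using matroid_on_indepD(1) by (fastforce simp: Ck_matroid_on_def)
  then have "finite (Collect (Ck_matroid_on k n))"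
    by (rule finite_subset) (simp add: finite_complete_edges)
  then obtain J where "Ck_matroid_on k n J" "I \<subseteq> J" "\<And>J'. Ck_matroid_on k n J' \<Longrightarrow> J \<subseteq> J' \<Longrightarrow> J = J'"
    using finite_has_maximal2[of "Collect (Ck_matroid_on k n)" I] assms by auto
  then show thesis
    using that[of J] unfolding maximal_Ck_matroid_on_def weak_le_def by (metis subsetI)
qed

theorem theorem5p2:
  fixes k n :: nat
  assumes "k \<ge> 5" and "n \<ge> ((k - 1) choose 2) + 2"
  shows "\<exists>M1 M2. maximal_Ck_matroid_on k n M1 \<and> maximal_Ck_matroid_on k n M2 \<and> M1 \<noteq> M2"
proof -
  have "3 \<le> k"
    using assms(1) by simp
  then obtain M1 M2 where "maximal_Ck_matroid_on k n M1" "graphic_indep n \<subseteq> M1"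
    "maximal_Ck_matroid_on k n M2" "paving_indep k n \<subseteq> M2"
    by (metis Ck_matroid_on_below_maximal Ck_matroid_on_graphic_indep Ck_matroid_on_paving_indep)
  \<comment> \<open>Were \<open>M1\<close> and \<open>M2\<close> equal, they would be a common upper
    bound of the two matroids.\<close>
  then show ?thesis
    using no_common_upper_bound[OF assms, of M1] by (auto simp: maximal_Ck_matroid_on_def)
qed

end
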